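(* Let $a\in\mathbb{R}$, $\alpha\in(0,1)$, and let $w:\mathbb{N}_a\to\mathbb{R}\setminus\{0\}$ satisfy $\frac{w(a)}{w(k)}>0$ for all $k\in\mathbb{N}_{a+1}$. Let $x:\mathbb{N}_a\to\mathbb{R}$. Then for all $k\in\mathbb{N}_{a+1}$: if $x(a)\ge 0$, then $${}_a^{\rm C}\nabla_k^{\alpha,w(k)}x(k)\le {}_{a-1}^{\ \ \ \rm R}\nabla_k^{\alpha,w(k)}x(k)\le {}_a^{\rm R}\nabla_k^{\alpha,w(k)}x(k);$$ and if $x(a)\le 0$, then $${}_a^{\rm C}\nabla_k^{\alpha,w(k)}x(k)\ge {}_{a-1}^{\ \ \ \rm R}\nabla_k^{\alpha,w(k)}x(k)\ge {}_a^{\rm R}\nabla_k^{\alpha,w(k)}x(k).$$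
   Context: For $a\in\mathbb{R}$, $\mathbb{N}_a:=\{a,a+1,a+2,\dots\}$. The nabla difference is $\nabla x(k):=x(k)-x(k-1)$. For $\beta\in(-1,1)$, the Grünwald–Letnikov difference/sum with base point $a$ is $${}_a^{\rm G}\nabla_k^{\beta}x(k):=\sum_{i=0}^{k-a-1}(-1)^i\binom{\beta}{i}x(k-i),\qquad \binom{p}{q}:=\frac{\Gamma(p+1)}{\Gamma(q+1)\Gamma(p-q+1)},$$ with the empty sum (at $k=a$) equal to $0$. For $\alpha\in(0,1)$ and $k\in\mathbb{N}_{a+1}$, the Riemann–Liouville and Caputo differences are ${}_a^{\rm R}\nabla_k^{\alpha}x(k):=\nabla\,{}_a^{\rm G}\nabla_k^{\alpha-1}x(k)$ and ${}_a^{\rm C}\nabla_k^{\alpha}x(k):={}_a^{\rm G}\nabla_k^{\alpha-1}\nabla x(k)$. Given a tempered function $w$, the tempered operators are ${}_a^{\rm R}\nabla_k^{\alpha,w(k)}x(k):=w^{-1}(k)\,{}_a^{\rm R}\nabla_k^{\alpha}[w(k)x(k)]$ and ${}_a^{\rm C}\nabla_k^{\alpha,w(k)}x(k):=w^{-1}(k)\,{}_a^{\rm C}\nabla_k^{\alpha}[w(k)x(k)]$, where $w^{-1}(k)=1/w(k)$. The operator ${}_{a-1}^{\ \ \ \rm R}\nabla_k^{\alpha,w(k)}$ is the same operator with base point $a-1$ in place of $a$ (for $k\in\mathbb{N}_{a+1}$ it only uses the values of $w,x$ on $\mathbb{N}_a$). *)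

theory Defs
  imports "HOL-Analysis.Analysis"
begin

definition Nfrom :: "real \<Rightarrow> real set" where
  "Nfrom a = {a + real n | n. True}"

definition nabla :: "(real \<Rightarrow> real) \<Rightarrow> real \<Rightarrow> real" where
  "nabla x k = x k - x (k - 1)"

text \<open>
  At a pole of \<open>Gamma (p - q + 1)\<close> the quotient is \<open>0\<close>, since \<open>Gamma\<close> is \<open>0\<close> at
  non-positive integers and division by \<open>0\<close> yields \<open>0\<close>; this agrees with the usual convention
  that the reciprocal Gamma function vanishes there.
\<close>
definition gamma_binomial :: "real \<Rightarrow> real \<Rightarrow> real" where
  "gamma_binomial p q = Gamma (p + 1) / (Gamma (q + 1) * Gamma (p - q + 1))"

text \<open>
  A function on \<open>Nfrom a\<close> is represented by a total function on the reals whose other values are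
  irrelevant. The index set below is \<open>{0..k - a - 1}\<close>; it is empty for \<open>k = a\<close>.
\<close>
definition GL_diff :: "real \<Rightarrow> real \<Rightarrow> (real \<Rightarrow> real) \<Rightarrow> real \<Rightarrow> real" where
  "GL_diff a \<beta> x k =
     (\<Sum>i | real i \<le> k - a - 1. (- 1) ^ i * gamma_binomial \<beta> (real i) * x (k - real i))"

definition RL_diff :: "real \<Rightarrow> real \<Rightarrow> (real \<Rightarrow> real) \<Rightarrow> real \<Rightarrow> real" where
  "RL_diff a \<alpha> x k = nabla (GL_diff a (\<alpha> - 1) x) k"

definition Caputo_diff :: "real \<Rightarrow> real \<Rightarrow> (real \<Rightarrow> real) \<Rightarrow> real \<Rightarrow> real" where
  "Caputo_diff a \<alpha> x k = GL_diff a (\<alpha> - 1) (nabla x) k"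

definition tempered_RL_diff ::
    "real \<Rightarrow> real \<Rightarrow> (real \<Rightarrow> real) \<Rightarrow> (real \<Rightarrow> real) \<Rightarrow> real \<Rightarrow> real" where
  "tempered_RL_diff a \<alpha> w x k = 1 / w k * RL_diff a \<alpha> (\<lambda>j. w j * x j) k"

definition tempered_Caputo_diff ::
    "real \<Rightarrow> real \<Rightarrow> (real \<Rightarrow> real) \<Rightarrow> (real \<Rightarrow> real) \<Rightarrow> real \<Rightarrow> real" where
  "tempered_Caputo_diff a \<alpha> w x k = 1 / w k * Caputo_diff a \<alpha> (\<lambda>j. w j * x j) k"

end

theory Submission
  imports Defs
begin

text \<open>
  Put \<open>y = w * x\<close> and \<open>c n = (- 1) ^ n * ((\<alpha> - 1) gchoose n)\<close>. At \<open>k = a + n\<close> with \<open>n \<ge> 1\<close> the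
  three untempered differences are the same linear expression in \<open>y\<close> up to the weight that they
  put on the initial value \<open>y a\<close>: passing from Caputo to Riemann--Liouville with base point
  \<open>a - 1\<close> adds \<open>c n * y a\<close>, and moving that base point up to \<open>a\<close> adds a further
  \<open>(c (n - 1) - c n) * y a\<close>
  (\<open>RL_diff_minus_Caputo_diff\<close>, \<open>RL_diff_shift_base\<close>).

  Since \<open>c n = pochhammer (1 - \<alpha>) n / fact n\<close> and \<open>0 < 1 - \<alpha> < 1\<close>, the coefficients are positive
  and decreasing in \<open>n\<close>, so both increments have the sign of \<open>y a\<close>. Tempering multiplies them by
  \<open>1 / w k\<close>, and \<open>y a / w k = (w a / w k) * x a\<close> has the sign of \<open>x a\<close>.
\<close>

definition GL_coeff :: "real \<Rightarrow> nat \<Rightarrow> real" where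
  "GL_coeff \<beta> i = (- 1) ^ i * gamma_binomial \<beta> (real i)"

text \<open>
  For \<open>\<beta> > -1\<close> the argument of the numerator \<open>Gamma (\<beta> + 1)\<close> avoids the poles, so the quotient of
  Gamma values is the generalized binomial coefficient; the signs are absorbed by negating its
  upper argument.
\<close>
lemma GL_coeff_pochhammer:
  assumes "\<beta> > -1"
  shows "GL_coeff \<beta> i = pochhammer (- \<beta>) i / fact i"
proof -
  have "\<beta> + 1 \<notin> \<int>\<^sub>\<le>\<^sub>0"
    using assms nonpos_Ints_nonpos[of "\<beta> + 1"] by linarith
  then have "gamma_binomial \<beta> (real i) = \<beta> gchoose i"
    using gbinomial_Gamma[of \<beta> i] by (simp add: gamma_binomial_def Gamma_fact add_ac)
  then show ?thesis
    by (simp add: GL_coeff_def gbinomial_pochhammer mult.assoc[symmetric]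
        power_mult_distrib[symmetric])
qed

lemma GL_coeff_pos:
  assumes "-1 < \<beta>" "\<beta> < 0"
  shows "GL_coeff \<beta> i > 0"
  using assms by (simp add: GL_coeff_pochhammer pochhammer_pos)

text \<open>The ratio of consecutive coefficients is \<open>(i - \<beta>) / (i + 1)\<close>, and \<open>- \<beta> \<le> 1\<close>.\<close>
lemma GL_coeff_Suc_le:
  assumes "-1 < \<beta>" "\<beta> < 0"
  shows "GL_coeff \<beta> (Suc i) \<le> GL_coeff \<beta> i"
proof -
  have "GL_coeff \<beta> (Suc i) = GL_coeff \<beta> i * ((real i - \<beta>) / (real i + 1))"
    using assms by (simp add: GL_coeff_pochhammer pochhammer_Suc field_simps)
  also have "\<dots> \<le> GL_coeff \<beta> i * 1"
    using assms GL_coeff_pos[OF assms, of i]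
    by (intro mult_left_mono) (auto simp: field_simps)
  finally show ?thesis by simp
qed

lemma GL_diff_eq_sum:
  assumes "k - a = real n"
  shows "GL_diff a \<beta> x k = (\<Sum>i<n. GL_coeff \<beta> i * x (k - real i))"
proof -
  have "{i. real i \<le> k - a - 1} = {..<n}"
    using assms by auto
  then show ?thesis
    by (simp add: GL_diff_def GL_coeff_def)
qed

text \<open>
  Taking the difference of the sum also differences its upper limit: the lowest term of the longer
  sum, the one at the base value \<open>y a\<close>, has no partner in the Caputo sum.
\<close>
lemma RL_diff_minus_Caputo_diff:
  assumes "k - a = real n"
  shows "RL_diff (a - 1) \<alpha> y k - Caputo_diff a \<alpha> y k = GL_coeff (\<alpha> - 1) n * y a"
proof -
  have k: "k - real n = a" and shift: "k - 1 - real i = k - real i - 1" for i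
    using assms by auto
  have "GL_diff (a - 1) (\<alpha> - 1) y k
      = (\<Sum>i<n. GL_coeff (\<alpha> - 1) i * y (k - real i)) + GL_coeff (\<alpha> - 1) n * y a"
    using assms k GL_diff_eq_sum[of k "a - 1" "Suc n"] by simp
  moreover have "GL_diff (a - 1) (\<alpha> - 1) y (k - 1)
      = (\<Sum>i<n. GL_coeff (\<alpha> - 1) i * y (k - real i - 1))"
    using assms GL_diff_eq_sum[of "k - 1" "a - 1" n] by (simp add: shift)
  moreover have "Caputo_diff a \<alpha> y k = (\<Sum>i<n. GL_coeff (\<alpha> - 1) i * y (k - real i))
      - (\<Sum>i<n. GL_coeff (\<alpha> - 1) i * y (k - real i - 1))"
    unfolding Caputo_diff_def GL_diff_eq_sum[OF assms]
    by (simp add: nabla_def right_diff_distrib sum_subtractf)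
  ultimately show ?thesis
    by (simp add: RL_diff_def nabla_def)
qed

text \<open>
  Lowering the base point by one appends a term at \<open>y a\<close> to each of the two sums, with
  coefficients of consecutive index.
\<close>
lemma RL_diff_shift_base:
  assumes "k - a = real (Suc m)"
  shows "RL_diff a \<alpha> y k - RL_diff (a - 1) \<alpha> y k
    = (GL_coeff (\<alpha> - 1) m - GL_coeff (\<alpha> - 1) (Suc m)) * y a"
proof -
  have k: "y (k - 1 - real m) = y a" "y (k - real (Suc m)) = y a"
    using assms by (auto intro!: arg_cong[of _ _ y])
  have "GL_diff (a - 1) (\<alpha> - 1) y k
      = GL_diff a (\<alpha> - 1) y k + GL_coeff (\<alpha> - 1) (Suc m) * y a"
    using assms k(2) GL_diff_eq_sum[of k "a - 1" "Suc (Suc m)"] GL_diff_eq_sum[of k a "Suc m"]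
    by (simp del: of_nat_Suc)
  moreover have "GL_diff (a - 1) (\<alpha> - 1) y (k - 1)
      = GL_diff a (\<alpha> - 1) y (k - 1) + GL_coeff (\<alpha> - 1) m * y a"
    using assms k(1) GL_diff_eq_sum[of "k - 1" "a - 1" "Suc m"]
      GL_diff_eq_sum[of "k - 1" a m]
    by simp
  ultimately show ?thesis
    by (simp add: RL_diff_def nabla_def algebra_simps)
qed

theorem theorem3p1:
  fixes a \<alpha> :: real and w x :: "real \<Rightarrow> real"
  assumes "0 < \<alpha>" and "\<alpha> < 1"
    and "\<And>k. k \<in> Nfrom a \<Longrightarrow> w k \<noteq> 0"
    and "\<And>k. k \<in> Nfrom (a + 1) \<Longrightarrow> w a / w k > 0"
  shows "\<forall>k \<in> Nfrom (a + 1).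
    (x a \<ge> 0 \<longrightarrow>
       tempered_Caputo_diff a \<alpha> w x k \<le> tempered_RL_diff (a - 1) \<alpha> w x k \<and>
       tempered_RL_diff (a - 1) \<alpha> w x k \<le> tempered_RL_diff a \<alpha> w x k) \<and>
    (x a \<le> 0 \<longrightarrow>
       tempered_Caputo_diff a \<alpha> w x k \<ge> tempered_RL_diff (a - 1) \<alpha> w x k \<and>
       tempered_RL_diff (a - 1) \<alpha> w x k \<ge> tempered_RL_diff a \<alpha> w x k)"
proof
  fix k assume k: "k \<in> Nfrom (a + 1)"
  then obtain m where m: "k - a = real (Suc m)"
    by (auto simp: Nfrom_def)
  let ?c = "GL_coeff (\<alpha> - 1)"
  define r where "r = w a / w k"
  have r: "r > 0"
    using assms(4)[OF k] by (simp add: r_def)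
  have c: "?c (Suc m) > 0" "?c m - ?c (Suc m) \<ge> 0"
    using assms(1,2) GL_coeff_pos[of "\<alpha> - 1" "Suc m"] GL_coeff_Suc_le[of "\<alpha> - 1" m] by auto
  have C: "tempered_RL_diff (a - 1) \<alpha> w x k - tempered_Caputo_diff a \<alpha> w x k
      = ?c (Suc m) * r * x a"
    unfolding tempered_RL_diff_def tempered_Caputo_diff_def r_def
      right_diff_distrib[symmetric] RL_diff_minus_Caputo_diff[OF m]
    by simp
  have R: "tempered_RL_diff a \<alpha> w x k - tempered_RL_diff (a - 1) \<alpha> w x k
      = (?c m - ?c (Suc m)) * r * x a"
    unfolding tempered_RL_diff_def r_def
      right_diff_distrib[symmetric] RL_diff_shift_base[OF m]
    by simp
  have weights: "?c (Suc m) * r \<ge> 0" "(?c m - ?c (Suc m)) * r \<ge> 0"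
    using c r by simp_all
  show "(x a \<ge> 0 \<longrightarrow>
       tempered_Caputo_diff a \<alpha> w x k \<le> tempered_RL_diff (a - 1) \<alpha> w x k \<and>
       tempered_RL_diff (a - 1) \<alpha> w x k \<le> tempered_RL_diff a \<alpha> w x k) \<and>
    (x a \<le> 0 \<longrightarrow>
       tempered_Caputo_diff a \<alpha> w x k \<ge> tempered_RL_diff (a - 1) \<alpha> w x k \<and>
       tempered_RL_diff (a - 1) \<alpha> w x k \<ge> tempered_RL_diff a \<alpha> w x k)"
    using C R weights[THEN mult_nonneg_nonneg, of "x a"] weights[THEN mult_nonneg_nonpos, of "x a"]
    by linarith
qed

end
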